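(* Let $m\ge 1$ and $n>1$ be integers. Then $n\text{-}\mathrm{TC}^m$ is digitally fiber $m$-homotopy invariant: if $(A,\kappa_1)$ and $(B,\kappa_1')$ are digitally connected digital images, $(A',\lambda_1)$ is a digital image, and $h:(A,\kappa_1)\to(A',\lambda_1)$ and $k:(B,\kappa_1')\to(A',\lambda_1)$ are digitally continuous functions that are digitally fiber $m$-homotopy equivalent, then $n\text{-}\mathrm{TC}^m(A,\kappa_1)=n\text{-}\mathrm{TC}^m(B,\kappa_1')$.
   Context: Digital images: a digital image is a pair $(A,\kappa)$ with $A\subseteq\mathbb{Z}^r$ and $\kappa$ an adjacency relation on $A$; the basic ones are $c_p$ ($1\le p\le r$), where distinct $a,a'\in\mathbb{Z}^r$ are $c_p$-adjacent iff there are at most $p$ indices $i$ with $|a_i-a'_i|=1$ and $a_i=a'_i$ for all other $i$. Subsets carry the restricted adjacency. $a\leftrightarrow_\kappa a'$ means adjacent. A map $h:(A,\kappa)\to(A',\lambda)$ is digitally $(\kappa,\lambda)$-continuous if $a\leftrightarrow_\kappa a'$ implies that $h(a)=h(a')$ or $h(a)\leftrightarrow_\lambda h(a')$. On a product of digital images, the adjacency $\mathrm{NP}$ (normal/strong product) declares two distinct points adjacent iff in each coordinate they are equal or adjacent. $(A,\kappa)$ is $\kappa$-connected if any two points are joined by a finite sequence $b_0,\dots,b_l$ in $A$ with $b_i=b_{i+1}$ or $b_i\leftrightarrow_\kappa b_{i+1}$ for each $i$. Homotopy: $[0,z]_{\mathbb{Z}}=\{0,1,\dots,z\}$ carries the adjacency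 $2=c_1$ of $\mathbb{Z}$. Digitally continuous $h,k:(A,\kappa)\to(A',\lambda)$ are digitally homotopic, $h\simeq_{\kappa,\lambda}k$, if for some $z$ there is a digitally continuous $K:(A\times[0,z]_{\mathbb{Z}},\mathrm{NP}(\kappa,2))\to(A',\lambda)$ with $K(a,0)=h(a)$, $K(a,z)=k(a)$ for all $a$. For $m>0$, an $m$-dimensional digital complex is a finite digital image $(P,\delta)$ with $P\subseteq\mathbb{Z}^m$. Digital fiber $m$-homotopy equivalence: digitally continuous $h:(A,\kappa_1)\to(A',\lambda_1)$ and $k:(B,\kappa_1')\to(A',\lambda_1)$ are digitally fiber $m$-homotopy equivalent if there are digitally continuous $v:A\to B$ and $w:B\to A$ with $k\circ v=h$, $h\circ w=k$, such that $v\circ w\circ\phi\simeq_{\delta,\kappa_1'}\phi$ and $w\circ v\circ\phi'\simeq_{\delta',\kappa_1}\phi'$ for all digitally continuous $\phi:(P,\delta)\to(B,\kappa_1')$ and $\phi':(P',\delta')\to(A,\kappa_1)$ with $P,P'$ any $m$-dimensional digital complexes. For digitally continuous $h_1,\dots,h_n:(C,\kappa)\to(C',\lambda)$, $\mathrm{D}_m(h_1,\dots,h_n)$ is the least integer $q\ge 0$ such that $C=X_0\cup\dots\cup X_q$ where, for each $j$, every $m$-dimensional digital complex $(P,\delta)$ and every $(\delta,\kappa)$-continuous $\phi:P\to X_j$ satisfy $h_1\circ\phi\simeq_{\delta,\lambda}\cdots\simeq_{\delta,\lambda}h_n\circ\phi$ ($\infty$ if none). For $n>1$ and a digitally connected $(A,\kappa_1)$,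 $n\text{-}\mathrm{TC}^m(A,\kappa_1)=\mathrm{D}_m(pr_1,\dots,pr_n)$, where $pr_i:A^n\to A$ are the projections and $A^n$ carries the NP adjacency. *)

theory Defs
  imports Main "HOL-Library.Extended_Nat"
begin

text \<open>
  A point of \<open>\<int>\<^sup>r\<close> is an integer list of length \<open>r\<close>. An image is given by a carrier set and an
  adjacency relation on it. Most notions below are polymorphic in the type of points, so that a
  product of images can be handled with pairs (or lists) of points instead of being flattened
  into a single integer vector.
\<close>

definition int_lattice :: "nat \<Rightarrow> int list set" where
  "int_lattice r = {x. length x = r}"

definition adjacency_on :: "'a set \<Rightarrow> 'a rel \<Rightarrow> bool" where
  "adjacency_on A \<kappa> \<longleftrightarrow> \<kappa> \<subseteq> A \<times> A \<and> sym \<kappa> \<and> irrefl \<kappa>"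

definition digital_image :: "nat \<Rightarrow> int list set \<Rightarrow> int list rel \<Rightarrow> bool" where
  "digital_image r A \<kappa> \<longleftrightarrow> A \<subseteq> int_lattice r \<and> adjacency_on A \<kappa>"

definition digital_complex :: "nat \<Rightarrow> int list set \<Rightarrow> int list rel \<Rightarrow> bool" where
  "digital_complex m P \<delta> \<longleftrightarrow> digital_image m P \<delta> \<and> finite P"

text \<open>
  Maps are total functions, of which only the values on the carrier matter. The relation on the
  codomain need not be restricted to it: for a subset \<open>X\<close> of an image with adjacency \<open>\<kappa>\<close>,
  continuity into \<open>X\<close> is the same for \<open>\<kappa>\<close> and for \<open>\<kappa>\<close> restricted to \<open>X\<close>.
\<close>

definition digitally_continuous ::
    "'a set \<Rightarrow> 'a rel \<Rightarrow> 'b set \<Rightarrow> 'b rel \<Rightarrow> ('a \<Rightarrow> 'b) \<Rightarrow> bool" where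
  "digitally_continuous A \<kappa> A' \<mu> h \<longleftrightarrow>
     h ` A \<subseteq> A' \<and>
     (\<forall>a\<in>A. \<forall>a'\<in>A. (a, a') \<in> \<kappa> \<longrightarrow> h a = h a' \<or> (h a, h a') \<in> \<mu>)"

definition digitally_connected :: "'a set \<Rightarrow> 'a rel \<Rightarrow> bool" where
  "digitally_connected A \<kappa> \<longleftrightarrow>
     (\<forall>x\<in>A. \<forall>y\<in>A. \<exists>(b :: nat \<Rightarrow> 'a) l.
        b 0 = x \<and> b l = y \<and> (\<forall>i\<le>l. b i \<in> A) \<and>
        (\<forall>i<l. b i = b (Suc i) \<or> (b i, b (Suc i)) \<in> \<kappa>))"

definition NP2 :: "'a set \<Rightarrow> 'a rel \<Rightarrow> 'b set \<Rightarrow> 'b rel \<Rightarrow> ('a \<times> 'b) rel" where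
  "NP2 A \<kappa> B \<mu> = {(p, q). p \<in> A \<times> B \<and> q \<in> A \<times> B \<and> p \<noteq> q \<and>
     (fst p = fst q \<or> (fst p, fst q) \<in> \<kappa>) \<and> (snd p = snd q \<or> (snd p, snd q) \<in> \<mu>)}"

definition image_power :: "nat \<Rightarrow> 'a set \<Rightarrow> 'a list set" where
  "image_power n A = {xs. length xs = n \<and> set xs \<subseteq> A}"

definition NP_power :: "nat \<Rightarrow> 'a set \<Rightarrow> 'a rel \<Rightarrow> 'a list rel" where
  "NP_power n A \<kappa> = {(xs, ys). xs \<in> image_power n A \<and> ys \<in> image_power n A \<and> xs \<noteq> ys \<and>
     (\<forall>i<n. xs ! i = ys ! i \<or> (xs ! i, ys ! i) \<in> \<kappa>)}"

text \<open>The adjacency \<open>c\<^sub>1\<close> of \<open>\<int>\<close> (also written \<open>2\<close>), restricted to \<open>{0, \<dots>, z}\<close>.\<close>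

definition interval_adj :: "nat \<Rightarrow> int rel" where
  "interval_adj z = {(s, t). s \<in> {0..int z} \<and> t \<in> {0..int z} \<and> \<bar>s - t\<bar> = 1}"

definition digitally_homotopic ::
    "'a set \<Rightarrow> 'a rel \<Rightarrow> 'b set \<Rightarrow> 'b rel \<Rightarrow> ('a \<Rightarrow> 'b) \<Rightarrow> ('a \<Rightarrow> 'b) \<Rightarrow> bool" where
  "digitally_homotopic A \<kappa> A' \<mu> h k \<longleftrightarrow>
     digitally_continuous A \<kappa> A' \<mu> h \<and> digitally_continuous A \<kappa> A' \<mu> k \<and>
     (\<exists>(z :: nat) (K :: 'a \<times> int \<Rightarrow> 'b).
        digitally_continuous (A \<times> {0..int z}) (NP2 A \<kappa> {0..int z} (interval_adj z)) A' \<mu> K \<and>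
        (\<forall>a\<in>A. K (a, 0) = h a \<and> K (a, int z) = k a))"

definition fiber_homotopy_equivalent ::
    "nat \<Rightarrow> 'a set \<Rightarrow> 'a rel \<Rightarrow> 'b set \<Rightarrow> 'b rel \<Rightarrow> 'c set \<Rightarrow> 'c rel \<Rightarrow>
     ('a \<Rightarrow> 'c) \<Rightarrow> ('b \<Rightarrow> 'c) \<Rightarrow> bool" where
  "fiber_homotopy_equivalent m A \<kappa> B \<kappa>' A' \<mu> h k \<longleftrightarrow>
     digitally_continuous A \<kappa> A' \<mu> h \<and> digitally_continuous B \<kappa>' A' \<mu> k \<and>
     (\<exists>v w. digitally_continuous A \<kappa> B \<kappa>' v \<and> digitally_continuous B \<kappa>' A \<kappa> w \<and>
        (\<forall>a\<in>A. (k \<circ> v) a = h a) \<and> (\<forall>b\<in>B. (h \<circ> w) b = k b) \<and>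
        (\<forall>P \<delta> \<phi>. digital_complex m P \<delta> \<longrightarrow> digitally_continuous P \<delta> B \<kappa>' \<phi> \<longrightarrow>
           digitally_homotopic P \<delta> B \<kappa>' (v \<circ> w \<circ> \<phi>) \<phi>) \<and>
        (\<forall>P' \<delta>' \<phi>'. digital_complex m P' \<delta>' \<longrightarrow> digitally_continuous P' \<delta>' A \<kappa> \<phi>' \<longrightarrow>
           digitally_homotopic P' \<delta>' A \<kappa> (w \<circ> v \<circ> \<phi>') \<phi>'))"

text \<open>
  The family \<open>h\<^sub>1, \<dots>, h\<^sub>n\<close> is indexed from \<open>0\<close> to \<open>n - 1\<close>. The infimum of the empty set in
  \<^typ>\<open>enat\<close> is \<open>\<infinity>\<close>.
\<close>

definition homotopic_distance ::
    "nat \<Rightarrow> 'a set \<Rightarrow> 'a rel \<Rightarrow> 'b set \<Rightarrow> 'b rel \<Rightarrow> nat \<Rightarrow> (nat \<Rightarrow> 'a \<Rightarrow> 'b) \<Rightarrow> enat" where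
  "homotopic_distance m C \<kappa> C' \<mu> n h =
     Inf {enat q | q. \<exists>X :: nat \<Rightarrow> 'a set. C = (\<Union>j\<le>q. X j) \<and>
       (\<forall>j\<le>q. \<forall>P \<delta> \<phi>. digital_complex m P \<delta> \<longrightarrow> digitally_continuous P \<delta> (X j) \<kappa> \<phi> \<longrightarrow>
          (\<forall>i. Suc i < n \<longrightarrow> digitally_homotopic P \<delta> C' \<mu> (h i \<circ> \<phi>) (h (Suc i) \<circ> \<phi>)))}"

definition higher_TC :: "nat \<Rightarrow> nat \<Rightarrow> 'a set \<Rightarrow> 'a rel \<Rightarrow> enat" where
  "higher_TC n m A \<kappa> =
     homotopic_distance m (image_power n A) (NP_power n A \<kappa>) A \<kappa> n (\<lambda>i xs. xs ! i)"

end

theory Submission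
  imports Defs
begin

text \<open>
  Only half of the equivalence is needed for each inequality: let \<open>v : A \<rightarrow> B\<close> and \<open>w : B \<rightarrow> A\<close>
  satisfy \<open>w \<circ> v \<circ> \<phi> \<simeq> \<phi>\<close> for all \<open>\<phi> : P \<rightarrow> A\<close>. A cover of \<open>B\<^sup>n\<close> pulls back along \<open>v\<^sup>n\<close> to a cover of
  \<open>A\<^sup>n\<close>. If \<open>\<phi>\<close> maps into a pulled back piece, then \<open>v\<^sup>n \<circ> \<phi>\<close> maps into the original piece, and
  \<open>pr\<^sub>i \<circ> \<phi> \<simeq> w \<circ> v \<circ> pr\<^sub>i \<circ> \<phi> = w \<circ> pr\<^sub>i \<circ> v\<^sup>n \<circ> \<phi> \<simeq> w \<circ> pr\<^sub>i\<^sub>+\<^sub>1 \<circ> v\<^sup>n \<circ> \<phi> \<simeq> pr\<^sub>i\<^sub>+\<^sub>1 \<circ> \<phi>\<close>.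
\<close>

lemma digitally_continuous_compose:
  assumes "digitally_continuous A \<kappa> B \<mu> f" "digitally_continuous B \<mu> C \<nu> g"
  shows "digitally_continuous A \<kappa> C \<nu> (g \<circ> f)"
  unfolding digitally_continuous_def
proof (intro conjI ballI impI)
  show "(g \<circ> f) ` A \<subseteq> C"
    using assms unfolding digitally_continuous_def by (simp add: image_subset_iff)
next
  fix a a' assume a: "a \<in> A" "a' \<in> A" "(a, a') \<in> \<kappa>"
  then have "f a \<in> B" "f a' \<in> B" "f a = f a' \<or> (f a, f a') \<in> \<mu>"
    using assms(1) unfolding digitally_continuous_def by auto
  then show "(g \<circ> f) a = (g \<circ> f) a' \<or> ((g \<circ> f) a, (g \<circ> f) a') \<in> \<nu>"
    using assms(2) unfolding digitally_continuous_def by auto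
qed

lemma digitally_continuous_cong:
  assumes "\<And>a. a \<in> A \<Longrightarrow> f a = g a"
  shows "digitally_continuous A \<kappa> B \<mu> f = digitally_continuous A \<kappa> B \<mu> g"
  using assms unfolding digitally_continuous_def by (auto simp: image_subset_iff)

text \<open>Maps are total functions, so composites that describe the same map may differ off the
  carrier. This lemma lets one replace the other in a homotopy.\<close>

lemma digitally_homotopic_cong:
  assumes "\<And>a. a \<in> A \<Longrightarrow> f a = f' a" "\<And>a. a \<in> A \<Longrightarrow> g a = g' a"
  shows "digitally_homotopic A \<kappa> B \<mu> f g = digitally_homotopic A \<kappa> B \<mu> f' g'"
  using assms digitally_continuous_cong[of A f f'] digitally_continuous_cong[of A g g']
  unfolding digitally_homotopic_def by simp

lemma digitally_homotopic_sym:
  assumes "digitally_homotopic A \<kappa> B \<mu> f g"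
  shows "digitally_homotopic A \<kappa> B \<mu> g f"
proof -
  obtain z K where
    K: "digitally_continuous (A \<times> {0..int z}) (NP2 A \<kappa> {0..int z} (interval_adj z)) B \<mu> K"
    and ends: "\<forall>a\<in>A. K (a, 0) = f a \<and> K (a, int z) = g a"
    using assms unfolding digitally_homotopic_def by blast
  \<comment> \<open>Time reversal preserves the adjacency of the cylinder, so composing
    \<open>K\<close> with it runs the homotopy backwards.\<close>
  have "digitally_continuous (A \<times> {0..int z}) (NP2 A \<kappa> {0..int z} (interval_adj z))
      (A \<times> {0..int z}) (NP2 A \<kappa> {0..int z} (interval_adj z)) (\<lambda>(a, t). (a, int z - t))"
    unfolding digitally_continuous_def NP2_def interval_adj_def by auto
  from digitally_continuous_compose[OF this K] ends assms show ?thesis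
    unfolding digitally_homotopic_def
    by (intro conjI exI[of _ z] exI[of _ "K \<circ> (\<lambda>(a, t). (a, int z - t))"]) auto
qed

lemma digitally_homotopic_trans:
  assumes "digitally_homotopic A \<kappa> B \<mu> f g" "digitally_homotopic A \<kappa> B \<mu> g h"
  shows "digitally_homotopic A \<kappa> B \<mu> f h"
proof -
  obtain y K where
    K: "digitally_continuous (A \<times> {0..int y}) (NP2 A \<kappa> {0..int y} (interval_adj y)) B \<mu> K"
    and K_ends: "\<And>a. a \<in> A \<Longrightarrow> K (a, 0) = f a" "\<And>a. a \<in> A \<Longrightarrow> K (a, int y) = g a"
    using assms(1) unfolding digitally_homotopic_def by blast
  obtain z L where
    L: "digitally_continuous (A \<times> {0..int z}) (NP2 A \<kappa> {0..int z} (interval_adj z)) B \<mu> L"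
    and L_ends: "\<And>a. a \<in> A \<Longrightarrow> L (a, 0) = g a" "\<And>a. a \<in> A \<Longrightarrow> L (a, int z) = h a"
    using assms(2) unfolding digitally_homotopic_def by blast
  \<comment> \<open>Concatenation: \<open>K\<close> runs first, then \<open>L\<close> with its time
    shifted by \<open>y\<close>.\<close>
  define M where "M = (\<lambda>(a, t). if t \<le> int y then K (a, t) else L (a, t - int y))"
  have M_K: "M (a, t) = K (a, t)" if "t \<le> int y" for a t
    using that by (simp add: M_def)
  \<comment> \<open>The formula for \<open>L\<close> holds at the junction \<open>t = int y\<close>
    too, because \<open>K\<close> ends and \<open>L\<close> starts at \<open>g\<close>. Thus each
    half is described on a closed interval.\<close>
  have M_L: "M (a, t) = L (a, t - int y)" if "a \<in> A" "int y \<le> t" for a t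
    using that K_ends L_ends by (cases "t = int y") (auto simp: M_def)
  have "digitally_continuous (A \<times> {0..int (y + z)})
      (NP2 A \<kappa> {0..int (y + z)} (interval_adj (y + z))) B \<mu> M"
    unfolding digitally_continuous_def
  proof (intro conjI ballI impI)
    show "M ` (A \<times> {0..int (y + z)}) \<subseteq> B"
      using K L by (auto simp: digitally_continuous_def M_def image_subset_iff)
  next
    fix p q assume "(p, q) \<in> NP2 A \<kappa> {0..int (y + z)} (interval_adj (y + z))"
    then obtain a s b t where pq: "p = (a, s)" "q = (b, t)" "a \<in> A" "b \<in> A"
        "0 \<le> s" "s \<le> int (y + z)" "0 \<le> t" "t \<le> int (y + z)" "p \<noteq> q"
        "a = b \<or> (a, b) \<in> \<kappa>" "s = t \<or> \<bar>s - t\<bar> = 1"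
      unfolding NP2_def interval_adj_def by (cases p, cases q) auto
    \<comment> \<open>Adjacent points have integer times at distance at most 1, so no edge jumps
      over the junction, and continuity can be checked in one half at a time.\<close>
    then consider "s \<le> int y" "t \<le> int y" | "int y \<le> s" "int y \<le> t"
      by linarith
    then show "M p = M q \<or> (M p, M q) \<in> \<mu>"
    proof cases
      case 1
      then have "((a, s), (b, t)) \<in> NP2 A \<kappa> {0..int y} (interval_adj y)"
        using pq unfolding NP2_def interval_adj_def by auto
      then have "K (a, s) = K (b, t) \<or> (K (a, s), K (b, t)) \<in> \<mu>"
        using K 1 pq unfolding digitally_continuous_def by auto
      then show ?thesis
        using 1 pq by (simp add: M_K)
    next
      case 2
      then have "((a, s - int y), (b, t - int y)) \<in> NP2 A \<kappa> {0..int z} (interval_adj z)"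
        using pq unfolding NP2_def interval_adj_def by auto
      then have "L (a, s - int y) = L (b, t - int y) \<or> (L (a, s - int y), L (b, t - int y)) \<in> \<mu>"
        using L 2 pq unfolding digitally_continuous_def by auto
      then show ?thesis
        using 2 pq by (simp add: M_L)
    qed
  qed
  moreover have "\<forall>a\<in>A. M (a, 0) = f a \<and> M (a, int (y + z)) = h a"
    using K_ends L_ends by (auto simp: M_K M_L)
  ultimately show ?thesis
    using assms unfolding digitally_homotopic_def by blast
qed

lemma digitally_homotopic_postcompose:
  assumes "digitally_homotopic A \<kappa> B \<mu> f g" "digitally_continuous B \<mu> C \<nu> w"
  shows "digitally_homotopic A \<kappa> C \<nu> (w \<circ> f) (w \<circ> g)"
proof -
  obtain z K where
    K: "digitally_continuous (A \<times> {0..int z}) (NP2 A \<kappa> {0..int z} (interval_adj z)) B \<mu> K"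
    and ends: "\<forall>a\<in>A. K (a, 0) = f a \<and> K (a, int z) = g a"
    using assms(1) unfolding digitally_homotopic_def by blast
  have "digitally_continuous A \<kappa> C \<nu> (w \<circ> f)" "digitally_continuous A \<kappa> C \<nu> (w \<circ> g)"
    using assms digitally_continuous_compose unfolding digitally_homotopic_def by blast+
  moreover have "\<forall>a\<in>A. (w \<circ> K) (a, 0) = (w \<circ> f) a \<and> (w \<circ> K) (a, int z) = (w \<circ> g) a"
    using ends by simp
  ultimately show ?thesis
    using digitally_continuous_compose[OF K assms(2)] unfolding digitally_homotopic_def by blast
qed

text \<open>The domain is a subset \<open>Y\<close> of the power, so that the projections are
  available on the single pieces of a cover.\<close>

lemma digitally_continuous_nth:
  assumes "Y \<subseteq> image_power n A" "i < n"
  shows "digitally_continuous Y (NP_power n A \<kappa>) A \<kappa> (\<lambda>xs. xs ! i)"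
  using assms unfolding digitally_continuous_def NP_power_def image_power_def
  by (auto simp: subset_iff)

text \<open>NP adjacency is tested coordinate by coordinate, and so is the continuity of
  \<open>map v\<close>. The domain is the preimage of \<open>X\<close>, so that a map into a pulled
  back piece can be followed by \<open>map v\<close> to give a map into the original piece.\<close>

lemma digitally_continuous_map:
  assumes "digitally_continuous A \<kappa> B \<mu> v"
  shows "digitally_continuous {xs \<in> image_power n A. map v xs \<in> X} (NP_power n A \<kappa>)
           X (NP_power n B \<mu>) (map v)"
  unfolding digitally_continuous_def
proof (intro conjI ballI impI)
  show "map v ` {xs \<in> image_power n A. map v xs \<in> X} \<subseteq> X"
    by auto
next
  fix xs ys assume "(xs, ys) \<in> NP_power n A \<kappa>"
  then have xy: "length xs = n" "length ys = n" "set xs \<subseteq> A" "set ys \<subseteq> A"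
      "\<forall>i<n. xs ! i = ys ! i \<or> (xs ! i, ys ! i) \<in> \<kappa>"
    by (auto simp: NP_power_def image_power_def)
  have "v (xs ! i) = v (ys ! i) \<or> (v (xs ! i), v (ys ! i)) \<in> \<mu>" if "i < n" for i
  proof -
    have "xs ! i \<in> A" "ys ! i \<in> A"
      using xy that by (auto simp: subset_iff)
    then show ?thesis
      using assms xy that unfolding digitally_continuous_def by metis
  qed
  moreover have "v ` A \<subseteq> B"
    using assms by (simp add: digitally_continuous_def)
  ultimately show "map v xs = map v ys \<or> (map v xs, map v ys) \<in> NP_power n B \<mu>"
    using xy by (auto simp: NP_power_def image_power_def subset_iff image_subset_iff)
qed

lemma higher_TC_le_of_domination:
  assumes v: "digitally_continuous A \<kappa> B \<mu> v" and w: "digitally_continuous B \<mu> A \<kappa> w"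
    and wv: "\<And>P \<delta> \<phi>. digital_complex m P \<delta> \<Longrightarrow> digitally_continuous P \<delta> A \<kappa> \<phi> \<Longrightarrow>
      digitally_homotopic P \<delta> A \<kappa> (w \<circ> v \<circ> \<phi>) \<phi>"
  shows "higher_TC n m A \<kappa> \<le> higher_TC n m B \<mu>"
  unfolding higher_TC_def homotopic_distance_def
\<comment> \<open>It suffices that every \<open>q\<close> admissible for \<open>B\<close> is
  admissible for \<open>A\<close>: the infimum over the larger set is the smaller one.\<close>
proof (rule Inf_superset_mono, clarify)
  fix q and X :: "nat \<Rightarrow> 'b list set"
  assume cover: "image_power n B = (\<Union>j\<le>q. X j)"
    and homotopic: "\<forall>j\<le>q. \<forall>P \<delta> \<phi>. digital_complex m P \<delta> \<longrightarrow>
      digitally_continuous P \<delta> (X j) (NP_power n B \<mu>) \<phi> \<longrightarrow>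
      (\<forall>i. Suc i < n \<longrightarrow>
        digitally_homotopic P \<delta> B \<mu> ((\<lambda>xs. xs ! i) \<circ> \<phi>) ((\<lambda>xs. xs ! Suc i) \<circ> \<phi>))"
  define Y where "Y j = {xs \<in> image_power n A. map v xs \<in> X j}" for j
  have "map v xs \<in> image_power n B" if "xs \<in> image_power n A" for xs
    using that v by (auto simp: image_power_def digitally_continuous_def)
  then have Y_cover: "image_power n A = (\<Union>j\<le>q. Y j)"
    unfolding Y_def cover by blast
  have Y_homotopic:
    "digitally_homotopic P \<delta> A \<kappa> ((\<lambda>xs. xs ! i) \<circ> \<phi>) ((\<lambda>xs. xs ! Suc i) \<circ> \<phi>)"
    if j: "j \<le> q" and P: "digital_complex m P \<delta>"
      and \<phi>: "digitally_continuous P \<delta> (Y j) (NP_power n A \<kappa>) \<phi>" and i: "Suc i < n"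
    for j P \<delta> \<phi> i
  proof -
    \<comment> \<open>\<open>map v xs ! l = v (xs ! l)\<close> is guaranteed only for
      \<open>l < length xs\<close>, hence the lengths are recorded.\<close>
    have len: "length (\<phi> p) = n" if "p \<in> P" for p
      using that \<phi> by (auto simp: digitally_continuous_def Y_def image_power_def)
    have wv_nth: "digitally_homotopic P \<delta> A \<kappa> (w \<circ> ((\<lambda>xs. xs ! l) \<circ> (map v \<circ> \<phi>)))
        ((\<lambda>xs. xs ! l) \<circ> \<phi>)" if "l < n" for l
    proof -
      have "digitally_continuous (Y j) (NP_power n A \<kappa>) A \<kappa> (\<lambda>xs. xs ! l)"
        using that by (intro digitally_continuous_nth) (auto simp: Y_def)
      then have "digitally_homotopic P \<delta> A \<kappa> (w \<circ> v \<circ> ((\<lambda>xs. xs ! l) \<circ> \<phi>)) ((\<lambda>xs. xs ! l) \<circ> \<phi>)"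
        using wv[OF P] digitally_continuous_compose[OF \<phi>] by blast
      then show ?thesis
        \<comment> \<open>On \<open>P\<close>, applying \<open>v\<close> after the projection is the
          same as projecting after \<open>map v\<close>.\<close>
        by (rule digitally_homotopic_cong[THEN iffD1, rotated -1]) (use len that in auto)
    qed
    have "digitally_continuous P \<delta> (X j) (NP_power n B \<mu>) (map v \<circ> \<phi>)"
      using digitally_continuous_compose[OF \<phi>[unfolded Y_def] digitally_continuous_map[OF v]] .
    then have "digitally_homotopic P \<delta> B \<mu> ((\<lambda>xs. xs ! i) \<circ> (map v \<circ> \<phi>))
        ((\<lambda>xs. xs ! Suc i) \<circ> (map v \<circ> \<phi>))"
      using homotopic j P i by blast
    then have "digitally_homotopic P \<delta> A \<kappa> (w \<circ> ((\<lambda>xs. xs ! i) \<circ> (map v \<circ> \<phi>)))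
        (w \<circ> ((\<lambda>xs. xs ! Suc i) \<circ> (map v \<circ> \<phi>)))"
      using w by (rule digitally_homotopic_postcompose)
    \<comment> \<open>The chain is glued at both ends by \<open>wv_nth\<close>, reversed at index
      \<open>i\<close> and used directly at \<open>Suc i\<close>.\<close>
    then have "digitally_homotopic P \<delta> A \<kappa> ((\<lambda>xs. xs ! i) \<circ> \<phi>)
        (w \<circ> ((\<lambda>xs. xs ! Suc i) \<circ> (map v \<circ> \<phi>)))"
      by (rule digitally_homotopic_trans[OF digitally_homotopic_sym[OF wv_nth[OF Suc_lessD[OF i]]]])
    then show ?thesis
      using wv_nth[OF i] by (rule digitally_homotopic_trans)
  qed
  show "\<exists>q'. enat q = enat q' \<and> (\<exists>X. image_power n A = (\<Union>j\<le>q'. X j) \<and>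
      (\<forall>j\<le>q'. \<forall>P \<delta> \<phi>. digital_complex m P \<delta> \<longrightarrow>
        digitally_continuous P \<delta> (X j) (NP_power n A \<kappa>) \<phi> \<longrightarrow>
        (\<forall>i. Suc i < n \<longrightarrow>
          digitally_homotopic P \<delta> A \<kappa> ((\<lambda>xs. xs ! i) \<circ> \<phi>) ((\<lambda>xs. xs ! Suc i) \<circ> \<phi>))))"
    by (intro exI[of _ q] exI[of _ Y] conjI refl Y_cover allI impI) (rule Y_homotopic)
qed

theorem proposition4p13:
  fixes m n r s t :: nat
    and A B A' :: "int list set"
    and \<kappa>\<^sub>1 \<kappa>\<^sub>1' \<mu>\<^sub>1 :: "int list rel"
    and h k :: "int list \<Rightarrow> int list"
  assumes "m \<ge> 1" and "n > 1"
    and "digital_image r A \<kappa>\<^sub>1" and "digitally_connected A \<kappa>\<^sub>1"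
    and "digital_image s B \<kappa>\<^sub>1'" and "digitally_connected B \<kappa>\<^sub>1'"
    and "digital_image t A' \<mu>\<^sub>1"
    and "digitally_continuous A \<kappa>\<^sub>1 A' \<mu>\<^sub>1 h"
    and "digitally_continuous B \<kappa>\<^sub>1' A' \<mu>\<^sub>1 k"
    and "fiber_homotopy_equivalent m A \<kappa>\<^sub>1 B \<kappa>\<^sub>1' A' \<mu>\<^sub>1 h k"
  shows "higher_TC n m A \<kappa>\<^sub>1 = higher_TC n m B \<kappa>\<^sub>1'"
proof -
  obtain v w where
    v: "digitally_continuous A \<kappa>\<^sub>1 B \<kappa>\<^sub>1' v" and w: "digitally_continuous B \<kappa>\<^sub>1' A \<kappa>\<^sub>1 w"
    and vw: "\<And>P \<delta> \<phi>. digital_complex m P \<delta> \<Longrightarrow> digitally_continuous P \<delta> B \<kappa>\<^sub>1' \<phi> \<Longrightarrow>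
      digitally_homotopic P \<delta> B \<kappa>\<^sub>1' (v \<circ> w \<circ> \<phi>) \<phi>"
    and wv: "\<And>P \<delta> \<phi>. digital_complex m P \<delta> \<Longrightarrow> digitally_continuous P \<delta> A \<kappa>\<^sub>1 \<phi> \<Longrightarrow>
      digitally_homotopic P \<delta> A \<kappa>\<^sub>1 (w \<circ> v \<circ> \<phi>) \<phi>"
    using assms(10) unfolding fiber_homotopy_equivalent_def by blast
  show ?thesis
    \<comment> \<open>Exchanging the roles of \<open>v\<close> and \<open>w\<close> gives the
      reverse inequality.\<close>
    using higher_TC_le_of_domination[OF v w wv] higher_TC_le_of_domination[OF w v vw]
    by (rule antisym)
qed

end
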